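(* Let $C\in[C_-,C_+]$, $C_\pm=\frac{25\pm\sqrt{105}}{780}$, and let $R$ be the stability function $$R(z)=-\frac{(183C-5)z^3+(972C-42)z^2+(1872C-168)z-288}{(z^2-12z+48)\,[9Cz^2-(39C+1)z+6]}.$$ As $z\to0$, $$R(z)-e^z=-\frac{75C-1}{2880}z^5-\frac{5850C^2+525C-7}{34560}z^6+O(z^7).$$ As $|z|\to\infty$, $$R(z)=\left(-\frac{61}{3}+\frac{5}{9C}\right)\frac1z+O(z^{-2}).$$ Consequently, the value $C=C_q=\frac{5}{183}$ cancels the $1/z$ term and gives $$R(z)=\frac{314}{5z^2}+O(z^{-3})\qquad(|z|\to\infty).$$
   Context: All objects are introduced in the claim; $z$ is a complex variable. *)

theory Defs
  imports Complex_Main "HOL-Library.Landau_Symbols"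
begin

definition C_minus :: real where
  "C_minus = (25 - sqrt 105) / 780"

definition C_plus :: real where
  "C_plus = (25 + sqrt 105) / 780"

definition C_q :: real where
  "C_q = 5 / 183"

definition stab_fun :: "real \<Rightarrow> complex \<Rightarrow> complex" where
  "stab_fun C z =
     - ((of_real (183 * C - 5) * z ^ 3 + of_real (972 * C - 42) * z ^ 2
          + of_real (1872 * C - 168) * z - 288)
        / ((z ^ 2 - 12 * z + 48)
           * (of_real (9 * C) * z ^ 2 - of_real (39 * C + 1) * z + 6)))"

end

theory Submission
  imports Defs "HOL-Analysis.Complex_Transcendental"
begin

text \<open>
  Both expansions are polynomial identities. At the origin, multiplying the degree-six
  approximation of \<open>exp\<close> (with corrected coefficients of \<open>z ^ 5\<close> and \<open>z ^ 6\<close>) by the denominator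
  reproduces the numerator up to a multiple of \<open>z ^ 7\<close>. At infinity, the substitution
  \<open>w = 1 / z\<close> turns the stability function into \<open>w\<close> times a quotient of polynomials in \<open>w\<close> whose
  denominator has the value \<open>9 * C\<close> at \<open>0\<close>, and this is nonzero since \<open>C_minus > 0\<close>.
\<close>

text \<open>A factor with a finite limit is bounded near the filter. The expansions of
  \<open>stab_fun\<close> are proved through this: the remainder is written exactly as the claimed
  power times such a factor.\<close>

lemma bigo_mult_tendsto:
  fixes h :: "'a \<Rightarrow> 'b::real_normed_field"
  assumes "(h \<longlongrightarrow> L) F" and "eventually (\<lambda>z. f z = g z * h z) F"
  shows "f \<in> O[F](g)"
proof -
  have "h \<in> O[F](\<lambda>_. 1)"
    using assms(1) by (intro bigoI_tendsto[where c = L]) auto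
  then have "(\<lambda>z. g z * h z) \<in> O[F](\<lambda>z. g z * 1)"
    by (rule landau_o.big.mult_left)
  then show ?thesis
    using landau_o.big.in_cong[OF assms(2)] by simp
qed

lemma exp_Taylor_bigo:
  "(\<lambda>z::complex. exp z - (\<Sum>k\<le>n. z ^ k / fact k)) \<in> O[at 0](\<lambda>z. z ^ Suc n)"
proof (rule bigoI)
  have "eventually (\<lambda>z::complex. z \<in> ball 0 1) (at 0)"
    by (intro eventually_at_in_open') auto
  then show "eventually (\<lambda>z::complex. norm (exp z - (\<Sum>k\<le>n. z ^ k / fact k))
      \<le> exp 1 / fact n * norm (z ^ Suc n)) (at 0)"
  proof eventually_elim
    case (elim z)
    have "\<bar>Re z\<bar> \<le> 1"
      using abs_Re_le_cmod[of z] elim by simp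
    then have "exp \<bar>Re z\<bar> * norm z ^ Suc n / fact n \<le> exp 1 * norm z ^ Suc n / fact n"
      by (intro divide_right_mono mult_right_mono) auto
    then show ?case
      using Taylor_exp[of z n] by (simp add: norm_power norm_mult)
  qed
qed

lemma C_minus_pos: "C_minus > 0"
proof -
  have "sqrt 105 < 25"
    by (rule real_less_lsqrt) auto
  then show ?thesis
    by (simp add: C_minus_def)
qed

lemma C_q_mem: "C_q \<in> {C_minus..C_plus}"
proof -
  \<comment> \<open>Since 780 * \<open>C_q\<close> is about 21.3, both bounds hold once
    \<open>sqrt 105\<close> is at least 3.7; 10 is a convenient integer bound.\<close>
  have "sqrt 105 \<ge> 10"
    by (rule real_le_rsqrt) auto
  then show ?thesis
    by (simp add: C_minus_def C_plus_def C_q_def)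
qed

lemma stab_fun_minus_poly_at_0:
  "(\<lambda>z. stab_fun C z - ((\<Sum>k\<le>6. z ^ k / fact k)
      - of_real ((75 * C - 1) / 2880) * z ^ 5
      - of_real ((5850 * C ^ 2 + 525 * C - 7) / 34560) * z ^ 6)) \<in> O[at 0](\<lambda>z. z ^ 7)"
proof -
  define c :: complex where "c = of_real C"
  define D where "D = (\<lambda>z. (z ^ 2 - 12 * z + 48) * (9 * c * z ^ 2 - (39 * c + 1) * z + 6))"
  \<comment> \<open>\<open>Q\<close> is the quotient of 34560 * (N + T * D) by z^7, with
    \<open>N\<close> and \<open>T\<close> the numerator and approximation defined below. The factor
    34560 clears every denominator in \<open>T\<close>; the product T * D has degree 10, so
    \<open>Q\<close> has degree 3.\<close>
  define Q where "Q = (\<lambda>z::complex. (- 2640 + 54000 * c + 874800 * c ^ 2 + 10951200 * c ^ 3)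
    + (690 + 9810 * c - 445500 * c ^ 2 - 5265000 * c ^ 3) * z
    + (- 55 - 4860 * c + 74925 * c ^ 2 + 859950 * c ^ 3) * z ^ 2
    + (495 * c - 4725 * c ^ 2 - 52650 * c ^ 3) * z ^ 3)"
  have D0: "D 0 = 288"
    by (simp add: D_def)
  have D_lim: "(D \<longlongrightarrow> D 0) (at 0)"
    unfolding D_def by (intro tendsto_intros)
  have Q_lim: "(Q \<longlongrightarrow> Q 0) (at 0)"
    unfolding Q_def by (intro tendsto_intros)
  have lim: "((\<lambda>z. - (Q z / (34560 * D z))) \<longlongrightarrow> - (Q 0 / (34560 * D 0))) (at 0)"
    by (intro tendsto_intros D_lim Q_lim) (simp add: D0)
  have "eventually (\<lambda>z. D z \<noteq> 0) (at 0)"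
    by (rule tendsto_imp_eventually_ne[OF D_lim]) (simp add: D0)
  then have "eventually (\<lambda>z. stab_fun C z - ((\<Sum>k\<le>6. z ^ k / fact k)
      - of_real ((75 * C - 1) / 2880) * z ^ 5
      - of_real ((5850 * C ^ 2 + 525 * C - 7) / 34560) * z ^ 6) = z ^ 7 * - (Q z / (34560 * D z))) (at 0)"
  proof eventually_elim
    case (elim z)
    define N where "N = (183 * c - 5) * z ^ 3 + (972 * c - 42) * z ^ 2 + (1872 * c - 168) * z - 288"
    define T where "T = 1 + z + z ^ 2 / 2 + z ^ 3 / 6 + z ^ 4 / 24 + z ^ 5 / 120 + z ^ 6 / 720
      - (75 * c - 1) / 2880 * z ^ 5 - (5850 * c ^ 2 + 525 * c - 7) / 34560 * z ^ 6"
    have "stab_fun C z = - (N / D z)"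
      by (simp add: stab_fun_def N_def D_def c_def)
    moreover have "(\<Sum>k\<le>6. z ^ k / fact k)
      - of_real ((75 * C - 1) / 2880) * z ^ 5
      - of_real ((5850 * C ^ 2 + 525 * C - 7) / 34560) * z ^ 6 = T"
      by (simp add: T_def c_def eval_nat_numeral)
    moreover have "- (N / D z) - T = z ^ 7 * - (Q z / (34560 * D z))"
    proof -
      have T: "34560 * T = 34560 + 34560 * z + 17280 * z ^ 2 + 5760 * z ^ 3 + 1440 * z ^ 4
          + 288 * z ^ 5 + 48 * z ^ 6 - 12 * (75 * c - 1) * z ^ 5
          - (5850 * c ^ 2 + 525 * c - 7) * z ^ 6"
        unfolding T_def by (simp add: algebra_simps diff_divide_distrib add_divide_distrib)
      \<comment> \<open>This is where the coefficients of z^5 and z^6 are checked: all terms of N +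
        T * D below z^7 cancel. The sum appears because \<open>stab_fun\<close> carries a leading
        minus sign.\<close>
      have "34560 * N + (34560 * T) * D z = z ^ 7 * Q z"
        unfolding T N_def D_def Q_def by algebra
      then have "z ^ 7 * - (Q z / (34560 * D z)) = - ((34560 * N + 34560 * T * D z) / (34560 * D z))"
        by simp
      also have "\<dots> = - (N / D z) - T"
        using elim by (simp add: add_divide_distrib)
      finally show ?thesis
        by simp
    qed
    ultimately show ?case
      by simp
  qed
  with lim show ?thesis
    by (rule bigo_mult_tendsto)
qed

text \<open>\<open>n\<close> and \<open>e\<close> are the numerator and denominator with reversed
  coefficients, n(w) = w^3 N(1/w) and e(w) = w^4 D(1/w). The degree gap of one is the extra factor
  1/z in \<open>stab_fun_inverse\<close>.\<close>

context
  fixes C :: real and n e :: "complex \<Rightarrow> complex"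
  defines "n \<equiv> \<lambda>w. of_real (183 * C - 5) + of_real (972 * C - 42) * w
    + of_real (1872 * C - 168) * w ^ 2 - 288 * w ^ 3"
    and "e \<equiv> \<lambda>w. (1 - 12 * w + 48 * w ^ 2)
      * (of_real (9 * C) - of_real (39 * C + 1) * w + 6 * w ^ 2)"
begin

lemma stab_fun_inverse: "z \<noteq> 0 \<Longrightarrow> stab_fun C z = - (1 / z) * (n (1 / z) / e (1 / z))"
proof -
  assume z: "z \<noteq> 0"
  let ?N = "of_real (183 * C - 5) * z ^ 3 + of_real (972 * C - 42) * z ^ 2
    + of_real (1872 * C - 168) * z - 288"
  have N: "?N = z ^ 3 * n (1 / z)"
    using z unfolding n_def by (simp add: field_simps eval_nat_numeral)
  have D1: "z ^ 2 - 12 * z + 48 = z ^ 2 * (1 - 12 * (1 / z) + 48 * (1 / z) ^ 2)"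
    using z by (simp add: field_simps eval_nat_numeral)
  have D2: "of_real (9 * C) * z ^ 2 - of_real (39 * C + 1) * z + 6
      = z ^ 2 * (of_real (9 * C) - of_real (39 * C + 1) * (1 / z) + 6 * (1 / z) ^ 2)"
    using z by (simp add: field_simps eval_nat_numeral)
  have D: "(z ^ 2 - 12 * z + 48) * (of_real (9 * C) * z ^ 2 - of_real (39 * C + 1) * z + 6)
      = z ^ 4 * e (1 / z)"
    unfolding D1 D2 e_def by (simp add: eval_nat_numeral mult_ac)
  have "z ^ 3 * n (1 / z) / (z ^ 4 * e (1 / z)) = 1 / z * (n (1 / z) / e (1 / z))"
    using z by (simp add: eval_nat_numeral)
  then show ?thesis
    unfolding stab_fun_def N D by simp
qed

text \<open>\<open>eq\<close> certifies that \<open>p\<close> agrees with -n/e at w = 0 up to order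
  \<open>k\<close>, so the error is exactly -(1/z) * (1/z)^k * q(1/z) / e(1/z). The prefactor 1/z
  raises the exponent to \<open>Suc k\<close>, and q/e has a finite limit as e(0) = 9C is
  nonzero.\<close>

lemma stab_fun_expansion_at_infinity:
  assumes "C \<noteq> 0" and "continuous_on UNIV q"
    and eq: "\<And>w. n w + p w * e w = w ^ k * q w"
  shows "(\<lambda>z. stab_fun C z - p (1 / z) / z) \<in> O[at_infinity](\<lambda>z. 1 / z ^ Suc k)"
proof -
  have inv: "filterlim (\<lambda>z::complex. 1 / z) (nhds 0) at_infinity"
    using tendsto_inverse_0[where 'a = complex] by (simp add: inverse_eq_divide[abs_def])
  have q_lim: "((\<lambda>z. q (1 / z)) \<longlongrightarrow> q 0) at_infinity"
    using assms(2) inv by (rule continuous_on_tendsto_compose) auto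
  have e_lim: "((\<lambda>z. e (1 / z)) \<longlongrightarrow> e 0) at_infinity"
    unfolding e_def by (intro tendsto_intros inv)
  have e0: "e 0 \<noteq> 0"
    using assms(1) by (simp add: e_def)
  have lim: "((\<lambda>z. - (q (1 / z) / e (1 / z))) \<longlongrightarrow> - (q 0 / e 0)) at_infinity"
    using e0 by (intro tendsto_intros q_lim e_lim)
  have "eventually (\<lambda>z::complex. z \<noteq> 0) at_infinity"
    unfolding eventually_at_infinity by (rule exI[of _ 1]) auto
  moreover have "eventually (\<lambda>z. e (1 / z) \<noteq> 0) at_infinity"
    using e_lim e0 by (rule tendsto_imp_eventually_ne)
  ultimately have "eventually (\<lambda>z. stab_fun C z - p (1 / z) / z
      = 1 / z ^ Suc k * - (q (1 / z) / e (1 / z))) at_infinity"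
  proof eventually_elim
    case (elim z)
    have "stab_fun C z - p (1 / z) / z = - (1 / z) * ((n (1 / z) + p (1 / z) * e (1 / z)) / e (1 / z))"
      using elim by (simp add: stab_fun_inverse add_divide_distrib distrib_left)
    then show ?case
      unfolding eq by (simp add: power_divide)
  qed
  with lim show ?thesis
    by (rule bigo_mult_tendsto)
qed

end

lemma stab_fun_at_0:
  "(\<lambda>z. (stab_fun C z - exp z)
      - (- of_real ((75 * C - 1) / 2880) * z ^ 5
         - of_real ((5850 * C ^ 2 + 525 * C - 7) / 34560) * z ^ 6)) \<in> O[at 0](\<lambda>z. z ^ 7)"
proof -
  have "(\<lambda>z::complex. exp z - (\<Sum>k\<le>6. z ^ k / fact k)) \<in> O[at 0](\<lambda>z. z ^ 7)"
    using exp_Taylor_bigo[of 6] by (simp add: eval_nat_numeral)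
  \<comment> \<open>Subtracting the two remainders cancels the Taylor sum.\<close>
  from sum_in_bigo(2)[OF stab_fun_minus_poly_at_0[of C] this] show ?thesis
    by (rule back_subst[of "\<lambda>f. f \<in> O[at 0](\<lambda>z. z ^ 7)"]) (simp add: fun_eq_iff)
qed

lemma stab_fun_at_infinity:
  assumes "C \<noteq> 0"
  shows "(\<lambda>z. stab_fun C z - of_real (- (61 / 3) + 5 / (9 * C)) * (1 / z))
    \<in> O[at_infinity](\<lambda>z. 1 / z ^ 2)"
proof -
  define c :: complex where "c = of_real C"
  define a :: complex where "a = of_real (- (61 / 3) + 5 / (9 * C))"
  \<comment> \<open>This says a * e(0) = -n(0), so n + a * e has no constant term; \<open>q\<close>
    below collects its remaining coefficients, shifted down by one degree.\<close>
  have a: "a * (9 * c) = 5 - 183 * c"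
    using assms by (simp add: a_def c_def field_simps)
  define q where "q = (\<lambda>w. (972 * c - 42 - a * (147 * c + 1)) + (1872 * c - 168 + a * (900 * c + 18)) * w
    + (- 288 - a * (1872 * c + 120)) * w ^ 2 + 288 * a * w ^ 3)"
  have "(\<lambda>z. stab_fun C z - a / z) \<in> O[at_infinity](\<lambda>z. 1 / z ^ Suc 1)"
  proof (rule stab_fun_expansion_at_infinity[OF assms])
    show "continuous_on UNIV q"
      unfolding q_def by (intro continuous_intros)
    show "of_real (183 * C - 5) + of_real (972 * C - 42) * w + of_real (1872 * C - 168) * w ^ 2
        - 288 * w ^ 3 + a * ((1 - 12 * w + 48 * w ^ 2)
        * (of_real (9 * C) - of_real (39 * C + 1) * w + 6 * w ^ 2)) = w ^ 1 * q w" for w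
      using a unfolding q_def by (simp add: c_def[symmetric]) algebra
  qed
  then show ?thesis
    by (simp add: a_def eval_nat_numeral)
qed

lemma stab_fun_C_q_at_infinity:
  "(\<lambda>z. stab_fun C_q z - 314 / (5 * z ^ 2)) \<in> O[at_infinity](\<lambda>z. 1 / z ^ 3)"
proof -
  define q :: "complex \<Rightarrow> complex" where "q = (\<lambda>w. (- 131724 / 305) + (727932 / 305) * w + (- 655632 / 61) * w ^ 2 + (90432 / 5) * w ^ 3)"
  \<comment> \<open>At \<open>C_q\<close> the constant term of \<open>n\<close> vanishes, so p(w) =
    (314/5) * w with 314/5 = (942/61) / (15/61) = -n'(0) / e(0). The term is written to match p(1/z)
    / z.\<close>
  have "(\<lambda>z. stab_fun C_q z - (314 / 5 * (1 / z)) / z) \<in> O[at_infinity](\<lambda>z. 1 / z ^ Suc 2)"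
  proof (rule stab_fun_expansion_at_infinity)
    show "C_q \<noteq> 0"
      by (simp add: C_q_def)
    show "continuous_on UNIV q"
      unfolding q_def by (intro continuous_intros)
    show "of_real (183 * C_q - 5) + of_real (972 * C_q - 42) * w + of_real (1872 * C_q - 168) * w ^ 2
        - 288 * w ^ 3 + 314 / 5 * w * ((1 - 12 * w + 48 * w ^ 2)
        * (of_real (9 * C_q) - of_real (39 * C_q + 1) * w + 6 * w ^ 2)) = w ^ 2 * q w" for w
      unfolding q_def C_q_def by (simp add: field_simps) algebra
  qed
  then show ?thesis
    by (simp add: numeral_3_eq_3 power2_eq_square mult.assoc)
qed

theorem proposition1:
  shows "(\<forall>C::real \<in> {C_minus..C_plus}.
            (\<lambda>z::complex. (stab_fun C z - exp z)
               - (- of_real ((75 * C - 1) / 2880) * z ^ 5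
                  - of_real ((5850 * C ^ 2 + 525 * C - 7) / 34560) * z ^ 6))
              \<in> O[at 0](\<lambda>z. z ^ 7) \<and>
            (\<lambda>z::complex. stab_fun C z - of_real (- (61 / 3) + 5 / (9 * C)) * (1 / z))
              \<in> O[at_infinity](\<lambda>z. 1 / z ^ 2)) \<and>
         C_q \<in> {C_minus..C_plus} \<and>
         - (61 / 3) + 5 / (9 * C_q) = 0 \<and>
         (\<lambda>z::complex. stab_fun C_q z - 314 / (5 * z ^ 2))
           \<in> O[at_infinity](\<lambda>z. 1 / z ^ 3)"
proof (intro conjI ballI)
  fix C assume "C \<in> {C_minus..C_plus}"
  then have "C \<noteq> 0"
    using C_minus_pos by auto
  then show "(\<lambda>z. stab_fun C z - of_real (- (61 / 3) + 5 / (9 * C)) * (1 / z))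
      \<in> O[at_infinity](\<lambda>z. 1 / z ^ 2)"
    by (rule stab_fun_at_infinity)
next
  show "- (61 / 3) + 5 / (9 * C_q) = 0"
    by (simp add: C_q_def)
qed (rule stab_fun_at_0 C_q_mem stab_fun_C_q_at_infinity)+

end
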